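(* Let $F$ be an Archimedean Riesz space and let $\ell_0^\infty$ be the Riesz space of eventually constant real sequences (with coordinatewise order). Then $\mathcal{L}^{oc}(\ell_0^{\infty},F)$ is a band of $\mathcal{L}^r(\ell_0^{\infty},F)$.
   Context: Riesz space = vector lattice. $\mathcal{L}^r(E,F)$ is the space of regular operators (differences of positive linear operators) $E\to F$, ordered by $S\le T$ iff $S(x)\le T(x)$ for all $x\in E_+$; it need not be a lattice. Order convergence in a Riesz space $X$: a net $x_\alpha\xrightarrow{o}x$ if there is a net $(b_\gamma)_{\gamma\in\Lambda}$ in $X$ (possibly with a different index set) with $b_\gamma\downarrow 0$ such that for every $\gamma$ there is $\alpha_0$ with $|x_\alpha-x|\le b_\gamma$ for all $\alpha\ge\alpha_0$. $\mathcal{L}^{oc}(E,F)$ is the space of all linear operators $T:E\to F$ (regularity is not assumed) such that $x_\alpha\xrightarrow{o}0$ in $E$ implies $T(x_\alpha)\xrightarrow{o}0$ in $F$ for every net $(x_\alpha)$ in $E$. In a partially ordered vector space $X$, for $A\subseteq X$ let $A^u$ be the set of upper bounds of $A$ in $X$. Elements $x,y$ are disjoint, $x\perp y$, if $\{x+y,-x-y\}^u=\{x-y,-x+y\}^u$. For a subset $Y\subseteq X$, $Y^d=\{x\in X\mid x\perp y\text{ for all }y\in Y\}$. A subspace $Y$ of $X$ is a band of $X$ if $Y^{dd}=Y$. (In particular the claim includes $\mathcal{L}^{oc}(\ell_0^\infty,F)\subseteq\mathcal{L}^r(\ell_0^\infty,F)$.) *)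

theory Defs
  imports Complex_Main "HOL-Library.Function_Algebras"
begin

section \<open>Riesz spaces\<close>

class riesz_space = ordered_real_vector + lattice

class archimedean_riesz_space = riesz_space +
  assumes archimedean: "(\<And>n::nat. 0 < n \<Longrightarrow> real n *\<^sub>R x \<le> y) \<Longrightarrow> x \<le> 0"

definition riesz_abs :: "'a::riesz_space \<Rightarrow> 'a" where
  "riesz_abs x = sup x (- x)"


section \<open>The Riesz space of eventually constant real sequences\<close>

typedef ec_seq = "{x :: nat \<Rightarrow> real. \<exists>c. eventually (\<lambda>n. x n = c) sequentially}"
  morphisms ec_nth Abs_ec_seq
  by (rule exI[of _ "\<lambda>_. 0"]) auto

setup_lifting type_definition_ec_seq

instantiation ec_seq :: riesz_space
begin

lift_definition zero_ec_seq :: ec_seq is "\<lambda>_. 0" by auto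

lift_definition plus_ec_seq :: "ec_seq \<Rightarrow> ec_seq \<Rightarrow> ec_seq" is "\<lambda>x y n. x n + y n"
  by (auto elim: eventually_elim2)

lift_definition minus_ec_seq :: "ec_seq \<Rightarrow> ec_seq \<Rightarrow> ec_seq" is "\<lambda>x y n. x n - y n"
  by (auto elim: eventually_elim2)

lift_definition uminus_ec_seq :: "ec_seq \<Rightarrow> ec_seq" is "\<lambda>x n. - x n"
  by (auto elim: eventually_mono)

lift_definition scaleR_ec_seq :: "real \<Rightarrow> ec_seq \<Rightarrow> ec_seq" is "\<lambda>r x n. r * x n"
  by (auto elim: eventually_mono)

lift_definition less_eq_ec_seq :: "ec_seq \<Rightarrow> ec_seq \<Rightarrow> bool" is "\<lambda>x y. \<forall>n. x n \<le> y n" .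

definition less_ec_seq :: "ec_seq \<Rightarrow> ec_seq \<Rightarrow> bool" where
  "less_ec_seq x y \<longleftrightarrow> x \<le> y \<and> \<not> y \<le> x"

lift_definition sup_ec_seq :: "ec_seq \<Rightarrow> ec_seq \<Rightarrow> ec_seq" is "\<lambda>x y n. max (x n) (y n)"
  by (auto elim: eventually_elim2)

lift_definition inf_ec_seq :: "ec_seq \<Rightarrow> ec_seq \<Rightarrow> ec_seq" is "\<lambda>x y n. min (x n) (y n)"
  by (auto elim: eventually_elim2)

instance
proof
  fix x y z :: ec_seq and a b :: real
  show "x + y + z = x + (y + z)" by transfer (simp add: add.assoc)
  show "x + y = y + x" by transfer (simp add: add.commute)
  show "0 + x = x" by transfer simp
  show "- x + x = 0" by transfer simp
  show "x - y = x + - y" by transfer simp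
  show "a *\<^sub>R (x + y) = a *\<^sub>R x + a *\<^sub>R y" by transfer (simp add: distrib_left)
  show "(a + b) *\<^sub>R x = a *\<^sub>R x + b *\<^sub>R x" by transfer (simp add: distrib_right)
  show "a *\<^sub>R b *\<^sub>R x = (a * b) *\<^sub>R x" by transfer (simp add: mult.assoc)
  show "1 *\<^sub>R x = x" by transfer simp
  show "(x < y) = (x \<le> y \<and> \<not> y \<le> x)" by (rule less_ec_seq_def)
  show "x \<le> x" by transfer simp
  show "x \<le> y \<Longrightarrow> y \<le> z \<Longrightarrow> x \<le> z" by transfer (meson order_trans)
  show "x \<le> y \<Longrightarrow> y \<le> x \<Longrightarrow> x = y" by transfer (auto intro: antisym)
  show "x \<le> y \<Longrightarrow> z + x \<le> z + y" by transfer simp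
  show "x \<le> y \<Longrightarrow> 0 \<le> a \<Longrightarrow> a *\<^sub>R x \<le> a *\<^sub>R y" by transfer (simp add: mult_left_mono)
  show "a \<le> b \<Longrightarrow> 0 \<le> x \<Longrightarrow> a *\<^sub>R x \<le> b *\<^sub>R x" by transfer (simp add: mult_right_mono)
  show "inf x y \<le> x" by transfer simp
  show "inf x y \<le> y" by transfer simp
  show "x \<le> y \<Longrightarrow> x \<le> z \<Longrightarrow> x \<le> inf y z" by transfer simp
  show "x \<le> sup x y" by transfer simp
  show "y \<le> sup x y" by transfer simp
  show "y \<le> x \<Longrightarrow> z \<le> x \<Longrightarrow> sup y z \<le> x" by transfer simp
qed

end


section \<open>Nets and order convergence\<close>

text \<open>\<open>(a, b) \<in> r\<close> is read as \<open>a \<le> b\<close>.\<close>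

definition directed_set :: "'i set \<Rightarrow> 'i rel \<Rightarrow> bool" where
  "directed_set A r \<longleftrightarrow>
     preorder_on A r \<and> A \<noteq> {} \<and> (\<forall>a\<in>A. \<forall>b\<in>A. \<exists>c\<in>A. (a, c) \<in> r \<and> (b, c) \<in> r)"

definition net_decreases_to_0 :: "'i set \<Rightarrow> 'i rel \<Rightarrow> ('i \<Rightarrow> 'a::riesz_space) \<Rightarrow> bool" where
  "net_decreases_to_0 G r b \<longleftrightarrow>
     directed_set G r \<and> (\<forall>(g, h)\<in>r. b h \<le> b g) \<and>
     (\<forall>g\<in>G. 0 \<le> b g) \<and> (\<forall>l. (\<forall>g\<in>G. l \<le> b g) \<longrightarrow> l \<le> 0)"

definition dominates_tails ::
  "'j set \<Rightarrow> ('j \<Rightarrow> 'a::riesz_space) \<Rightarrow> 'i set \<Rightarrow> 'i rel \<Rightarrow> ('i \<Rightarrow> 'a) \<Rightarrow> 'a \<Rightarrow> bool" where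
  "dominates_tails G b A r x l \<longleftrightarrow>
     (\<forall>g\<in>G. \<exists>a0\<in>A. \<forall>a\<in>A. (a0, a) \<in> r \<longrightarrow> riesz_abs (x a - l) \<le> b g)"

text \<open>A definition cannot quantify over types, so the dominating net is indexed by elements of
  the space itself. The lemma \<open>order_convergesI\<close> below shows that dominating nets
  over arbitrary index types give nothing more.\<close>

definition order_converges ::
  "'i set \<Rightarrow> 'i rel \<Rightarrow> ('i \<Rightarrow> 'a::riesz_space) \<Rightarrow> 'a \<Rightarrow> bool" where
  "order_converges A r x l \<longleftrightarrow>
     (\<exists>(G :: 'a set) s b. net_decreases_to_0 G s b \<and> dominates_tails G b A r x l)"

lemma order_convergesI:
  fixes G :: "'j set" and x :: "'i \<Rightarrow> 'a::riesz_space"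
  assumes b: "net_decreases_to_0 G s b" and dom: "dominates_tails G b A r x l"
  shows "order_converges A r x l"
  unfolding order_converges_def
proof (intro exI conjI)
  let ?H = "b ` G" and ?t = "{(u, v). u \<in> b ` G \<and> v \<in> b ` G \<and> v \<le> u}"
  have dir: "directed_set G s" and dec: "\<And>g h. (g, h) \<in> s \<Longrightarrow> b h \<le> b g"
    using b by (auto simp: net_decreases_to_0_def)
  have "\<exists>w\<in>?H. (u, w) \<in> ?t \<and> (v, w) \<in> ?t" if "u \<in> ?H" "v \<in> ?H" for u v
  proof -
    from that obtain g h where gh: "g \<in> G" "h \<in> G" "u = b g" "v = b h" by blast
    then obtain k where "k \<in> G" "(g, k) \<in> s" "(h, k) \<in> s"
      using dir unfolding directed_set_def by blast
    with gh dec show ?thesis by (intro bexI[of _ "b k"]) auto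
  qed
  moreover have "?H \<noteq> {}" using dir by (auto simp: directed_set_def)
  moreover have "preorder_on ?H ?t"
    unfolding preorder_on_def refl_on_def trans_def by (auto intro: order_trans)
  ultimately have "directed_set ?H ?t" unfolding directed_set_def by blast
  then show "net_decreases_to_0 ?H ?t (\<lambda>u. u)"
    using b unfolding net_decreases_to_0_def by auto
  show "dominates_tails ?H (\<lambda>u. u) A r x l"
    using dom unfolding dominates_tails_def by auto
qed


section \<open>Operators\<close>

text \<open>Functions into a real vector space form a real vector space, so that
  spaces of operators are subspaces in the sense of the library.\<close>

instantiation "fun" :: (type, real_vector) real_vector
begin

definition scaleR_fun :: "real \<Rightarrow> ('a \<Rightarrow> 'b) \<Rightarrow> 'a \<Rightarrow> 'b" where
  "scaleR_fun r f = (\<lambda>x. r *\<^sub>R f x)"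

instance
  by standard (auto simp: scaleR_fun_def fun_eq_iff scaleR_add_right scaleR_add_left)

end

definition positive_operator :: "('a::riesz_space \<Rightarrow> 'b::riesz_space) \<Rightarrow> bool" where
  "positive_operator T \<longleftrightarrow> linear T \<and> (\<forall>x\<ge>0. 0 \<le> T x)"

definition regular_operators :: "('a::riesz_space \<Rightarrow> 'b::riesz_space) set" where
  "regular_operators = {S - T | S T. positive_operator S \<and> positive_operator T}"

text \<open>This differs from the library order on functions, which compares the values at all
  arguments rather than on the positive cone.\<close>

definition operator_le :: "('a::riesz_space \<Rightarrow> 'b::riesz_space) \<Rightarrow> ('a \<Rightarrow> 'b) \<Rightarrow> bool" where
  "operator_le S T \<longleftrightarrow> (\<forall>x\<ge>0. S x \<le> T x)"

text \<open>For the same reason as above, nets range over directed sets in the fixed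
  type \<open>'a \<times> 'a set\<close>. The lemma \<open>order_continuous_operatorsD\<close>
  below shows that this covers nets over arbitrary index types.\<close>

definition order_continuous_operators :: "('a::riesz_space \<Rightarrow> 'b::riesz_space) set" where
  "order_continuous_operators =
     {T. linear T \<and>
        (\<forall>(A :: ('a \<times> 'a set) set) r x. directed_set A r \<longrightarrow>
           order_converges A r x 0 \<longrightarrow> order_converges A r (\<lambda>a. T (x a)) 0)}"

lemma order_continuous_operatorsD:
  fixes A :: "'i set" and T :: "'a::riesz_space \<Rightarrow> 'b::riesz_space"
  assumes T: "T \<in> order_continuous_operators"
    and dir: "directed_set A r" and conv: "order_converges A r x 0"
  shows "order_converges A r (\<lambda>a. T (x a)) 0"
proof -
  define tl where "tl = (\<lambda>b. x ` {c \<in> A. (b, c) \<in> r})"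
  define B where "B = {(x a, tl b) | a b. b \<in> A \<and> a \<in> A \<and> (b, a) \<in> r}"
  define s where "s = {(p, q). p \<in> B \<and> q \<in> B \<and> snd q \<subseteq> snd p}"
  have refl: "\<And>a. a \<in> A \<Longrightarrow> (a, a) \<in> r"
    and trans: "\<And>a b c. (a, b) \<in> r \<Longrightarrow> (b, c) \<in> r \<Longrightarrow> (a, c) \<in> r"
    and ne: "A \<noteq> {}"
    and ub: "\<And>a b. a \<in> A \<Longrightarrow> b \<in> A \<Longrightarrow> \<exists>c\<in>A. (a, c) \<in> r \<and> (b, c) \<in> r"
    using dir unfolding directed_set_def preorder_on_def refl_on_def trans_def by blast+
  have tl_mono: "tl b \<subseteq> tl a" if "(a, b) \<in> r" for a b
    using that trans unfolding tl_def by blast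
  have B_tl: "fst p \<in> snd p" if "p \<in> B" for p
    using that unfolding B_def tl_def by auto
  have dirB: "directed_set B s"
    unfolding directed_set_def
  proof (intro conjI ballI)
    show "preorder_on B s"
      unfolding preorder_on_def refl_on_def trans_def s_def by auto
    show "B \<noteq> {}" using ne refl unfolding B_def by blast
    fix p q assume p: "p \<in> B" and q: "q \<in> B"
    then obtain a b where ab: "a \<in> A" "b \<in> A" "snd p = tl a" "snd q = tl b"
      unfolding B_def by auto
    then obtain c where c: "c \<in> A" "(a, c) \<in> r" "(b, c) \<in> r" using ub by blast
    have "(x c, tl c) \<in> B" using c refl unfolding B_def by blast
    then show "\<exists>u\<in>B. (p, u) \<in> s \<and> (q, u) \<in> s"
      using p q ab c tl_mono unfolding s_def by (intro bexI[of _ "(x c, tl c)"]) auto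
  qed
  have tails: "(\<exists>p0\<in>B. \<forall>p\<in>B. (p0, p) \<in> s \<longrightarrow> P (fst p))
      \<longleftrightarrow> (\<exists>a0\<in>A. \<forall>a\<in>A. (a0, a) \<in> r \<longrightarrow> P (x a))" for P
  proof
    assume "\<exists>p0\<in>B. \<forall>p\<in>B. (p0, p) \<in> s \<longrightarrow> P (fst p)"
    then obtain p0 where p0: "p0 \<in> B"
      and P: "\<And>p. p \<in> B \<Longrightarrow> (p0, p) \<in> s \<Longrightarrow> P (fst p)" by blast
    from p0 obtain a0 where a0: "a0 \<in> A" "snd p0 = tl a0" unfolding B_def by auto
    have "P (x a)" if "a \<in> A" "(a0, a) \<in> r" for a
    proof -
      have "(x a, tl a0) \<in> B" using that a0 unfolding B_def by blast
      with p0 a0 P[of "(x a, tl a0)"] show ?thesis by (simp add: s_def)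
    qed
    with a0 show "\<exists>a0\<in>A. \<forall>a\<in>A. (a0, a) \<in> r \<longrightarrow> P (x a)" by blast
  next
    assume "\<exists>a0\<in>A. \<forall>a\<in>A. (a0, a) \<in> r \<longrightarrow> P (x a)"
    then obtain a0 where a0: "a0 \<in> A"
      and P: "\<And>a. a \<in> A \<Longrightarrow> (a0, a) \<in> r \<Longrightarrow> P (x a)" by blast
    have "(x a0, tl a0) \<in> B" using a0 refl unfolding B_def by blast
    moreover have "P (fst p)" if "p \<in> B" "((x a0, tl a0), p) \<in> s" for p
    proof -
      have "fst p \<in> tl a0" using that B_tl unfolding s_def by auto
      then show ?thesis using P unfolding tl_def by auto
    qed
    ultimately show "\<exists>p0\<in>B. \<forall>p\<in>B. (p0, p) \<in> s \<longrightarrow> P (fst p)" by blast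
  qed
  have "order_converges B s fst 0"
    using conv unfolding order_converges_def dominates_tails_def
    by (simp only: tails[of "\<lambda>y. riesz_abs (y - 0) \<le> _"])
  with T dirB have "order_converges B s (\<lambda>p. T (fst p)) 0"
    unfolding order_continuous_operators_def by blast
  then show ?thesis unfolding order_converges_def dominates_tails_def
    by (simp only: tails[of "\<lambda>y. riesz_abs (T y - 0) \<le> _"])
qed


section \<open>Disjointness and bands in partially ordered vector spaces\<close>

text \<open>The partially ordered vector space is given by a subspace \<open>X\<close> of an ambient
  vector space and an order relation \<open>le\<close> on it. Upper bounds are taken in \<open>X\<close>.\<close>

definition upper_bounds :: "'v set \<Rightarrow> ('v \<Rightarrow> 'v \<Rightarrow> bool) \<Rightarrow> 'v set \<Rightarrow> 'v set" where
  "upper_bounds X le A = {u \<in> X. \<forall>a\<in>A. le a u}"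

definition pov_disjoint ::
  "'v::real_vector set \<Rightarrow> ('v \<Rightarrow> 'v \<Rightarrow> bool) \<Rightarrow> 'v \<Rightarrow> 'v \<Rightarrow> bool" where
  "pov_disjoint X le x y \<longleftrightarrow>
     upper_bounds X le {x + y, - x - y} = upper_bounds X le {x - y, - x + y}"

definition disjoint_complement ::
  "'v::real_vector set \<Rightarrow> ('v \<Rightarrow> 'v \<Rightarrow> bool) \<Rightarrow> 'v set \<Rightarrow> 'v set" where
  "disjoint_complement X le Y = {x \<in> X. \<forall>y\<in>Y. pov_disjoint X le x y}"

definition is_band :: "'v::real_vector set \<Rightarrow> ('v \<Rightarrow> 'v \<Rightarrow> bool) \<Rightarrow> 'v set \<Rightarrow> bool" where
  "is_band X le Y \<longleftrightarrow>
     Y \<subseteq> X \<and> subspace Y \<and> disjoint_complement X le (disjoint_complement X le Y) = Y"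

end

theory Submission
  imports Defs
begin

text \<open>
  Write \<open>e\<^sub>n\<close> for the unit sequences and \<open>w\<^sub>N\<close> for the sequence that is \<open>0\<close> before \<open>N\<close> and \<open>1\<close> from
  \<open>N\<close> on. Every eventually constant sequence is a combination of finitely many \<open>e\<^sub>n\<close> and one \<open>w\<^sub>N\<close>, so an
  operator is positive as soon as it is nonnegative at all \<open>e\<^sub>n\<close> and \<open>w\<^sub>N\<close>
  (\<open>positive_operatorI_units_tails\<close>). The only order-theoretic subtlety of the space sits at
  infinity: \<open>w\<^sub>N\<close> decreases to \<open>0\<close>, and order continuity of \<open>T\<close> says exactly that \<open>T\<close> becomes
  small on the order intervals \<open>[-w\<^sub>N, w\<^sub>N]\<close>. Let \<open>tail_bounds T\<close> be the set of all \<open>b\<close> that dominate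
  \<open>\<bar>T x\<bar>\<close> for all \<open>x\<close> in one of these intervals. Then a linear \<open>T\<close> is order continuous if and only if
  \<open>tail_bounds T\<close> is nonempty and has infimum \<open>0\<close> (\<open>order_continuous_iff\<close>). Such a \<open>T\<close> is
  regular: applied to all choices of signs, a single tail bound controls the sums of the \<open>\<bar>T e\<^sub>n\<bar>\<close>, which
  yields a positive operator above \<open>T\<close> (\<open>order_continuous_imp_regular\<close>).

  The operators \<open>x \<mapsto> lim x \<cdot> r\<close> live entirely at infinity, and they detect failure of order
  continuity. If \<open>T\<close> is order continuous, a regular \<open>V\<close> dominates \<open>\<plusminus>(T + lim \<cdot> r)\<close> if and only if
  \<open>V e\<^sub>n \<ge> \<bar>T e\<^sub>n\<bar>\<close> and \<open>V w\<^sub>N \<ge> \<bar>T w\<^sub>N\<bar> + \<bar>r\<bar>\<close> for all \<open>n\<close> and \<open>N\<close>, which does not change when \<open>r\<close> is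
  replaced by \<open>-r\<close>. Hence all these operators lie in the disjoint complement of the order continuous ones.

  Conversely, let \<open>T = T\<^sub>1 - T\<^sub>2\<close> with \<open>T\<^sub>1, T\<^sub>2\<close> positive be disjoint from all of them. Whenever
  \<open>y\<close> and \<open>z\<close> are such that \<open>P = T\<^sub>1 + lim \<cdot> y\<close> and \<open>Q = T\<^sub>2 + lim \<cdot> z\<close> are still positive, the operator
  \<open>P + Q\<close> dominates \<open>\<plusminus>(P - Q) = \<plusminus>(T + lim \<cdot> (y - z))\<close>. Disjointness makes it dominate
  \<open>\<plusminus>(T - lim \<cdot> (y - z))\<close> too, hence also \<open>\<plusminus>T\<close>, so its value at each \<open>w\<^sub>N\<close> is a tail bound of \<open>T\<close>. The
  values \<open>P w\<^sub>N = y + T\<^sub>1 w\<^sub>N\<close>, for all \<open>N\<close> and all \<open>y\<close> that positivity permits, have infimum \<open>0\<close>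
  because \<open>F\<close> is Archimedean (\<open>inf_of_shifts_le_0\<close>), and so do the values \<open>Q w\<^sub>N\<close>. Hence the tail bounds
  have infimum \<open>0\<close> and \<open>T\<close> is order continuous. No suprema have to exist in \<open>F\<close>: the shifts
  take over the part that order limits would play in a Dedekind complete space.
\<close>

section \<open>Absolute values in Riesz spaces\<close>

lemma riesz_abs_le_iff: "riesz_abs x \<le> b \<longleftrightarrow> x \<le> b \<and> - x \<le> b"
  by (simp add: riesz_abs_def)

lemma riesz_abs_ge: "x \<le> riesz_abs x" "- x \<le> riesz_abs x"
  by (simp_all add: riesz_abs_def)

lemma add_self_le_imp_le:
  fixes x y :: "'a::ordered_real_vector"
  assumes "x + x \<le> y + y"
  shows "x \<le> y"
proof -
  have "2 *\<^sub>R x \<le> 2 *\<^sub>R y" using assms by (simp add: scaleR_2)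
  from scaleR_left_mono[OF this, of "1/2"] show ?thesis by simp
qed

lemma riesz_abs_nonneg: "0 \<le> riesz_abs (x::'a::riesz_space)"
proof -
  have "x + - x \<le> riesz_abs x + riesz_abs x"
    by (intro add_mono riesz_abs_ge)
  then have "0 + 0 \<le> riesz_abs x + riesz_abs x" by simp
  then show ?thesis by (rule add_self_le_imp_le)
qed

lemma riesz_abs_zero [simp]: "riesz_abs (0::'a::riesz_space) = 0"
  by (simp add: riesz_abs_def)

lemma riesz_abs_minus [simp]: "riesz_abs (- x::'a::riesz_space) = riesz_abs x"
  by (simp add: riesz_abs_def sup.commute)

lemma riesz_abs_triangle: "riesz_abs (x + y) \<le> riesz_abs x + riesz_abs (y::'a::riesz_space)"
  using add_mono[OF riesz_abs_ge(1)[of x] riesz_abs_ge(1)[of y]]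
    add_mono[OF riesz_abs_ge(2)[of x] riesz_abs_ge(2)[of y]]
  by (simp add: riesz_abs_le_iff)

lemma riesz_abs_sum: "riesz_abs (sum f A) \<le> (\<Sum>i\<in>A. riesz_abs (f i::'a::riesz_space))"
proof (induction A rule: infinite_finite_induct)
  case (insert i A)
  have "riesz_abs (f i + sum f A) \<le> riesz_abs (f i) + riesz_abs (sum f A)"
    by (rule riesz_abs_triangle)
  also have "\<dots> \<le> riesz_abs (f i) + (\<Sum>i\<in>A. riesz_abs (f i))"
    using insert.IH by simp
  finally show ?case using insert.hyps by simp
qed auto

lemma riesz_abs_scaleR: "riesz_abs (c *\<^sub>R x) \<le> \<bar>c\<bar> *\<^sub>R riesz_abs (x::'a::riesz_space)"
proof -
  have "d *\<^sub>R x \<le> \<bar>d\<bar> *\<^sub>R riesz_abs x" for d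
  proof (cases "d \<ge> 0")
    case True
    then show ?thesis using scaleR_left_mono[OF riesz_abs_ge(1)[of x], of d] by simp
  next
    case False
    then show ?thesis using scaleR_left_mono[OF riesz_abs_ge(2)[of x], of "-d"] by simp
  qed
  from this[of c] this[of "-c"] show ?thesis by (simp add: riesz_abs_le_iff)
qed

text \<open>Splitting \<open>2 x\<close> as the difference of \<open>\<bar>x\<bar> + x\<close> and \<open>\<bar>x\<bar> - x\<close>, both in the positive cone, avoids
  the identities for positive and negative parts.\<close>

lemma operator_dominated_abs_le:
  fixes T V :: "'a::riesz_space \<Rightarrow> 'b::riesz_space"
  assumes T: "linear T" and V: "linear V"
    and le: "\<And>y. 0 \<le> y \<Longrightarrow> T y \<le> V y" "\<And>y. 0 \<le> y \<Longrightarrow> - T y \<le> V y"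
  shows "riesz_abs (T x) \<le> V (riesz_abs x)"
proof -
  have pos: "0 \<le> riesz_abs x + x" "0 \<le> riesz_abs x - x"
    using riesz_abs_ge(1)[of x] add_mono[OF riesz_abs_ge(2)[of x] order_refl[of x]] by simp_all
  have "T x + T x \<le> V (riesz_abs x) + V (riesz_abs x)"
    using add_mono[OF le(1)[OF pos(1)] le(2)[OF pos(2)]]
    by (simp add: linear_add[OF T] linear_add[OF V] linear_diff[OF T] linear_diff[OF V])
  moreover have "- T x + - T x \<le> V (riesz_abs x) + V (riesz_abs x)"
    using add_mono[OF le(2)[OF pos(1)] le(1)[OF pos(2)]]
    by (simp add: linear_add[OF T] linear_add[OF V] linear_diff[OF T] linear_diff[OF V])
  ultimately show ?thesis unfolding riesz_abs_le_iff by (blast dest: add_self_le_imp_le)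
qed

lemma positive_operator_mono:
  assumes "positive_operator T" "x \<le> y"
  shows "T x \<le> T y"
proof -
  have "0 \<le> T (y - x)" using assms by (auto simp: positive_operator_def)
  then show ?thesis using assms by (simp add: positive_operator_def linear_diff)
qed

lemma positive_operator_add:
  assumes "positive_operator S" "positive_operator T"
  shows "positive_operator (S + T)"
proof -
  have "linear (\<lambda>x. S x + T x)"
    using assms by (intro linear_compose_add) (simp_all add: positive_operator_def)
  then show ?thesis using assms by (simp add: positive_operator_def plus_fun_def)
qed

lemma positive_imp_regular:
  fixes T :: "'a::riesz_space \<Rightarrow> 'b::riesz_space"
  assumes "positive_operator T"
  shows "T \<in> regular_operators"
proof -
  have "positive_operator (0 :: 'a \<Rightarrow> 'b)"
    by (simp add: positive_operator_def linear_zero zero_fun_def)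
  moreover have "T = T - 0" by simp
  ultimately show ?thesis using assms unfolding regular_operators_def by blast
qed

lemma regular_imp_linear:
  assumes "T \<in> regular_operators"
  shows "linear T"
proof -
  obtain P Q where "T = P - Q" "linear P" "linear Q"
    using assms by (auto simp: regular_operators_def positive_operator_def)
  then show ?thesis using linear_compose_sub[of P Q] by (simp add: fun_diff_def)
qed


section \<open>Sets with infimum zero and order convergence\<close>

text \<open>Nonemptiness is part of the notion: an empty set of bounds must not count as arbitrarily small.\<close>

definition has_inf_0 :: "'a::riesz_space set \<Rightarrow> bool" where
  "has_inf_0 B \<longleftrightarrow> B \<noteq> {} \<and> (\<forall>b\<in>B. 0 \<le> b) \<and> (\<forall>l. (\<forall>b\<in>B. l \<le> b) \<longrightarrow> l \<le> 0)"

lemma has_inf_0_scaleD: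
  assumes B: "has_inf_0 B" and "0 < c" and l: "\<And>b. b \<in> B \<Longrightarrow> l \<le> c *\<^sub>R b"
  shows "l \<le> 0"
proof -
  have "(1/c) *\<^sub>R l \<le> b" if "b \<in> B" for b
    using scaleR_left_mono[OF l[OF that], of "1/c"] \<open>0 < c\<close> by simp
  then have "(1/c) *\<^sub>R l \<le> 0" using B by (auto simp: has_inf_0_def)
  from scaleR_left_mono[OF this, of c] \<open>0 < c\<close> show ?thesis by simp
qed

lemma directed_eventually_conj:
  assumes "directed_set A r"
    and "\<exists>a0\<in>A. \<forall>a\<in>A. (a0, a) \<in> r \<longrightarrow> P a" "\<exists>a0\<in>A. \<forall>a\<in>A. (a0, a) \<in> r \<longrightarrow> Q a"
  shows "\<exists>a0\<in>A. \<forall>a\<in>A. (a0, a) \<in> r \<longrightarrow> P a \<and> Q a"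
proof -
  from assms(2,3) obtain p q where pq: "p \<in> A" "q \<in> A"
    and P: "\<And>a. a \<in> A \<Longrightarrow> (p, a) \<in> r \<Longrightarrow> P a" and Q: "\<And>a. a \<in> A \<Longrightarrow> (q, a) \<in> r \<Longrightarrow> Q a"
    by blast
  then obtain c where "c \<in> A" "(p, c) \<in> r" "(q, c) \<in> r"
    using assms(1) unfolding directed_set_def by blast
  moreover have "trans r" using assms(1) by (simp add: directed_set_def preorder_on_def)
  ultimately show ?thesis using P Q by (meson transD)
qed

lemma directed_eventually_all_less:
  fixes N :: nat
  assumes dir: "directed_set A r"
    and ev: "\<And>n. n < N \<Longrightarrow> \<exists>a0\<in>A. \<forall>a\<in>A. (a0, a) \<in> r \<longrightarrow> P n a"
  shows "\<exists>a0\<in>A. \<forall>a\<in>A. (a0, a) \<in> r \<longrightarrow> (\<forall>n<N. P n a)"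
  using ev
proof (induction N)
  case 0
  then show ?case using dir by (auto simp: directed_set_def)
next
  case (Suc N)
  then have "\<exists>a0\<in>A. \<forall>a\<in>A. (a0, a) \<in> r \<longrightarrow> (\<forall>n<N. P n a) \<and> P N a"
    by (intro directed_eventually_conj[OF dir]) auto
  then show ?case by (simp add: less_Suc_eq) blast
qed

text \<open>The set of all bounds of tails of \<open>x - l\<close> is closed under binary infima because the net is
  directed. So it is itself a dominating net, indexed by its own elements, and order convergence can be
  proved without choosing a net.\<close>

lemma order_converges_if_bounds_inf_0:
  fixes x :: "'i \<Rightarrow> 'a::riesz_space"
  assumes dir: "directed_set A r"
    and B: "has_inf_0 {b. \<exists>a0\<in>A. \<forall>a\<in>A. (a0, a) \<in> r \<longrightarrow> riesz_abs (x a - l) \<le> b}"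
      (is "has_inf_0 ?B")
  shows "order_converges A r x l"
proof (rule order_convergesI)
  let ?s = "{(u, v). u \<in> ?B \<and> v \<in> ?B \<and> v \<le> u}"
  have "\<exists>w\<in>?B. (u, w) \<in> ?s \<and> (v, w) \<in> ?s" if "u \<in> ?B" "v \<in> ?B" for u v
  proof -
    have "inf u v \<in> ?B" using directed_eventually_conj[OF dir] that by simp
    with that show ?thesis by (intro bexI[of _ "inf u v"]) auto
  qed
  moreover have "preorder_on ?B ?s"
    unfolding preorder_on_def refl_on_def trans_def by (auto intro: order_trans)
  moreover have "?B \<noteq> {}" using B unfolding has_inf_0_def by blast
  ultimately have "directed_set ?B ?s" unfolding directed_set_def by blast
  then show "net_decreases_to_0 ?B ?s (\<lambda>u. u)"
    using B unfolding net_decreases_to_0_def has_inf_0_def by blast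
  show "dominates_tails ?B (\<lambda>u. u) A r x l"
    unfolding dominates_tails_def by blast
qed


section \<open>Coordinates of eventually constant sequences\<close>

lemmas ec_nth_simps [simp] =
  zero_ec_seq.rep_eq plus_ec_seq.rep_eq minus_ec_seq.rep_eq uminus_ec_seq.rep_eq
  scaleR_ec_seq.rep_eq sup_ec_seq.rep_eq inf_ec_seq.rep_eq

lemma ec_nth_abs [simp]: "ec_nth (riesz_abs x) n = \<bar>ec_nth x n\<bar>"
  by (simp add: riesz_abs_def max_def abs_if)

lemma ec_nth_sum [simp]: "ec_nth (sum f A) n = (\<Sum>i\<in>A. ec_nth (f i) n)"
  by (induction A rule: infinite_finite_induct) auto

lemma ec_seq_eqI: "(\<And>n. ec_nth x n = ec_nth y n) \<Longrightarrow> x = y"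
  by (simp add: ec_nth_inject[symmetric] fun_eq_iff)

lift_definition ec_unit :: "nat \<Rightarrow> ec_seq" is "\<lambda>n k. if k = n then 1 else 0"
proof -
  fix n :: nat
  show "\<exists>c. eventually (\<lambda>k. (if k = n then 1 else 0 :: real) = c) sequentially"
    by (intro exI[of _ 0] eventually_sequentiallyI[of "Suc n"]) auto
qed

lift_definition ec_tail :: "nat \<Rightarrow> ec_seq" is "\<lambda>n k. if n \<le> k then 1 else 0"
  by (intro exI[of _ 1] eventually_sequentiallyI) auto

lemmas ec_basis_nth [simp] = ec_unit.rep_eq ec_tail.rep_eq

lemma ec_basis_nonneg [simp]: "0 \<le> ec_unit n" "0 \<le> ec_tail n"
  by (simp_all add: less_eq_ec_seq.rep_eq)

lemma ec_tail_antimono: "M \<le> N \<Longrightarrow> ec_tail N \<le> ec_tail M"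
  by (auto simp: less_eq_ec_seq.rep_eq)

lemma tail_bound_nth_le: "riesz_abs x \<le> ec_tail N \<longleftrightarrow> (\<forall>n. \<bar>ec_nth x n\<bar> \<le> (if N \<le> n then 1 else 0))"
  by (simp add: less_eq_ec_seq.rep_eq)

definition ec_lim :: "ec_seq \<Rightarrow> real" where
  "ec_lim x = lim (ec_nth x)"

lemma ec_lim_eqI: "eventually (\<lambda>n. ec_nth x n = c) sequentially \<Longrightarrow> ec_lim x = c"
  unfolding ec_lim_def by (intro limI tendsto_eventually)

lemma eventually_ec_lim: "eventually (\<lambda>n. ec_nth x n = ec_lim x) sequentially"
proof -
  obtain c where "eventually (\<lambda>n. ec_nth x n = c) sequentially"
    using ec_nth[of x] by auto
  with ec_lim_eqI[OF this] show ?thesis by simp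
qed

lemma ec_limE:
  obtains K where "\<And>n. n \<ge> K \<Longrightarrow> ec_nth x n = ec_lim x"
  using eventually_ec_lim[of x] by (auto simp: eventually_sequentially)

lemma ec_lim_add [simp]: "ec_lim (x + y) = ec_lim x + ec_lim y"
  by (intro ec_lim_eqI eventually_elim2[OF eventually_ec_lim[of x] eventually_ec_lim[of y]]) simp

lemma ec_lim_diff [simp]: "ec_lim (x - y) = ec_lim x - ec_lim y"
  by (intro ec_lim_eqI eventually_elim2[OF eventually_ec_lim[of x] eventually_ec_lim[of y]]) simp

lemma ec_lim_scaleR [simp]: "ec_lim (c *\<^sub>R x) = c * ec_lim x"
  by (intro ec_lim_eqI eventually_mono[OF eventually_ec_lim[of x]]) simp

lemma ec_lim_nonneg: "0 \<le> x \<Longrightarrow> 0 \<le> ec_lim x"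
  using ec_limE[of x] by (auto simp: less_eq_ec_seq.rep_eq) (metis order_refl)

lemma ec_lim_unit [simp]: "ec_lim (ec_unit n) = 0"
  by (intro ec_lim_eqI eventually_sequentiallyI[of "Suc n"]) auto

lemma ec_lim_tail [simp]: "ec_lim (ec_tail n) = 1"
  by (intro ec_lim_eqI eventually_sequentiallyI[of n]) auto

lemma ec_seq_bounded: "\<exists>K>0. \<forall>n. \<bar>ec_nth x n\<bar> \<le> K"
proof -
  have "(ec_nth x) \<longlonglongrightarrow> ec_lim x" by (rule tendsto_eventually[OF eventually_ec_lim])
  then have "Bseq (ec_nth x)" by (intro convergent_imp_Bseq convergentI)
  then show ?thesis by (auto simp: Bseq_def)
qed

text \<open>Any \<open>K\<close> beyond the point of stabilization is allowed, so that finitely many sequences can be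
  expanded with the same \<open>K\<close>.\<close>

lemma ec_seq_expand:
  assumes "\<And>n. n \<ge> K \<Longrightarrow> ec_nth x n = ec_lim x"
  shows "x = (\<Sum>n<K. ec_nth x n *\<^sub>R ec_unit n) + ec_lim x *\<^sub>R ec_tail K"
proof (rule ec_seq_eqI)
  fix k
  have "(\<Sum>n<K. ec_nth x n * (if k = n then 1 else 0)) = (if k < K then ec_nth x k else 0)"
    by (simp add: if_distrib[of "\<lambda>u. _ * u"] cong: if_cong)
  then show "ec_nth x k = ec_nth ((\<Sum>n<K. ec_nth x n *\<^sub>R ec_unit n) + ec_lim x *\<^sub>R ec_tail K) k"
    using assms[of k] by auto
qed

text \<open>In the expansion of a nonnegative sequence all coefficients are nonnegative, and the tail may start
  as late as desired. This is why nonnegativity is asked only for late tails.\<close>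

lemma positive_operatorI_units_tails:
  assumes T: "linear T" and units: "\<And>n. 0 \<le> T (ec_unit n)"
    and tails: "\<And>n. N \<le> n \<Longrightarrow> 0 \<le> T (ec_tail n)"
  shows "positive_operator T"
  unfolding positive_operator_def
proof (intro conjI allI impI T)
  fix x :: ec_seq assume x: "0 \<le> x"
  then have nth: "0 \<le> ec_nth x n" for n by (simp add: less_eq_ec_seq.rep_eq)
  obtain K where K: "\<And>n. n \<ge> K \<Longrightarrow> ec_nth x n = ec_lim x" using ec_limE by blast
  have "T x = T ((\<Sum>n<max K N. ec_nth x n *\<^sub>R ec_unit n) + ec_lim x *\<^sub>R ec_tail (max K N))"
    using ec_seq_expand[of "max K N" x] K by simp
  also have "\<dots> = (\<Sum>n<max K N. ec_nth x n *\<^sub>R T (ec_unit n)) + ec_lim x *\<^sub>R T (ec_tail (max K N))"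
    by (simp add: linear_add[OF T] linear_sum[OF T] linear_scale[OF T])
  also have "\<dots> \<ge> 0"
    using x by (intro add_nonneg_nonneg sum_nonneg scaleR_nonneg_nonneg nth units tails ec_lim_nonneg) auto
  finally show "0 \<le> T x" .
qed

text \<open>The values at the unit sequences and at the constant sequence \<open>1\<close> (here \<open>v\<close>) are free parameters.
  The equation at \<open>N = 0\<close> is the prescription at \<open>1\<close>; the others follow by linearity.\<close>

lemma operator_with_given_coordinates:
  fixes s :: "nat \<Rightarrow> 'b::real_vector"
  obtains S where "linear S" "\<And>n. S (ec_unit n) = s n"
    "\<And>N. S (ec_tail N) = v - (\<Sum>n<N. s n)"
proof
  \<comment> \<open>The sum is finite, but its range depends on \<open>x\<close>. For linearity it is rewritten over a common \<open>{..<K}\<close>.\<close>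
  define S where "S = (\<lambda>x. ec_lim x *\<^sub>R v + (\<Sum>n | ec_nth x n \<noteq> ec_lim x. (ec_nth x n - ec_lim x) *\<^sub>R s n))"
  have S_eq: "S x = ec_lim x *\<^sub>R v + (\<Sum>n<K. (ec_nth x n - ec_lim x) *\<^sub>R s n)"
    if "\<And>n. n \<ge> K \<Longrightarrow> ec_nth x n = ec_lim x" for x K
    unfolding S_def using that
    by (intro arg_cong2[of _ _ _ _ "(+)"] refl sum.mono_neutral_left) (auto simp: not_le[symmetric])
  show "linear S"
  proof (rule linearI)
    fix x y :: ec_seq
    obtain K where K: "\<And>n. n \<ge> K \<Longrightarrow> ec_nth x n = ec_lim x" using ec_limE by blast
    obtain K' where K': "\<And>n. n \<ge> K' \<Longrightarrow> ec_nth y n = ec_lim y" using ec_limE by blast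
    let ?K = "max K K'"
    have "S (x + y) = ec_lim (x + y) *\<^sub>R v + (\<Sum>n<?K. (ec_nth (x + y) n - ec_lim (x + y)) *\<^sub>R s n)"
      by (rule S_eq) (simp add: K K')
    moreover have "S x = ec_lim x *\<^sub>R v + (\<Sum>n<?K. (ec_nth x n - ec_lim x) *\<^sub>R s n)"
      by (rule S_eq) (simp add: K)
    moreover have "S y = ec_lim y *\<^sub>R v + (\<Sum>n<?K. (ec_nth y n - ec_lim y) *\<^sub>R s n)"
      by (rule S_eq) (simp add: K')
    ultimately show "S (x + y) = S x + S y"
      by (simp add: sum.distrib[symmetric] algebra_simps)
  next
    fix c and x :: ec_seq
    obtain K where K: "\<And>n. n \<ge> K \<Longrightarrow> ec_nth x n = ec_lim x" using ec_limE by blast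
    have "S (c *\<^sub>R x) = ec_lim (c *\<^sub>R x) *\<^sub>R v + (\<Sum>n<K. (ec_nth (c *\<^sub>R x) n - ec_lim (c *\<^sub>R x)) *\<^sub>R s n)"
      by (rule S_eq) (simp add: K)
    moreover have "S x = ec_lim x *\<^sub>R v + (\<Sum>n<K. (ec_nth x n - ec_lim x) *\<^sub>R s n)"
      by (rule S_eq) (simp add: K)
    ultimately show "S (c *\<^sub>R x) = c *\<^sub>R S x"
      by (simp add: scaleR_sum_right scaleR_add_right right_diff_distrib)
  qed
  show "S (ec_unit n) = s n" for n
    by (subst S_eq[of "Suc n"]) auto
  show "S (ec_tail N) = v - (\<Sum>n<N. s n)" for N
    by (subst S_eq[of N]) (auto simp: sum_negf)
qed


section \<open>Order continuity and the tails\<close>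

text \<open>These are the bounds of \<open>\<bar>T x\<bar>\<close> over the order intervals \<open>[-w\<^sub>N, w\<^sub>N]\<close>, which shrink to \<open>0\<close>.\<close>

definition tail_bounds :: "(ec_seq \<Rightarrow> 'b::riesz_space) \<Rightarrow> 'b set" where
  "tail_bounds T = {b. \<exists>N. \<forall>x. riesz_abs x \<le> ec_tail N \<longrightarrow> riesz_abs (T x) \<le> b}"

lemma tail_boundsE:
  assumes "b \<in> tail_bounds T"
  obtains N where "\<And>x. riesz_abs x \<le> ec_tail N \<Longrightarrow> riesz_abs (T x) \<le> b"
  using assms by (auto simp: tail_bounds_def)

lemma tail_bounds_nonneg: "b \<in> tail_bounds T \<Longrightarrow> 0 \<le> b"
proof -
  assume "b \<in> tail_bounds T"
  then obtain N where "\<And>x. riesz_abs x \<le> ec_tail N \<Longrightarrow> riesz_abs (T x) \<le> b"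
    by (rule tail_boundsE) blast
  from this[of 0] have "riesz_abs (T 0) \<le> b" by simp
  with riesz_abs_nonneg[of "T 0"] show "0 \<le> b" by (rule order_trans)
qed

text \<open>Apply order continuity to the net of all pairs \<open>(N, x)\<close> with \<open>\<bar>x\<bar> \<le> w\<^sub>N\<close>, directed by \<open>N\<close> alone. It
  converges to \<open>0\<close>, and a bound of a tail of its image bounds \<open>T\<close> on a whole interval
  \<open>[-w\<^sub>N, w\<^sub>N]\<close>.\<close>

lemma tail_bounds_inf_0_if_order_continuous:
  fixes T :: "ec_seq \<Rightarrow> 'b::riesz_space"
  assumes T: "T \<in> order_continuous_operators"
  shows "has_inf_0 (tail_bounds T)"
proof -
  define A where "A = {p :: nat \<times> ec_seq. riesz_abs (snd p) \<le> ec_tail (fst p)}"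
  define r where "r = {(p, q). p \<in> A \<and> q \<in> A \<and> fst p \<le> fst q}"
  define s where "s = {(m, n::nat). m \<le> n}"
  have A0: "(n, 0) \<in> A" for n by (simp add: A_def)
  have dir: "directed_set A r"
    unfolding directed_set_def
  proof (intro conjI ballI)
    show "preorder_on A r"
      unfolding preorder_on_def refl_on_def trans_def r_def by auto
    show "A \<noteq> {}" using A0 by blast
    fix p q assume "p \<in> A" "q \<in> A"
    then show "\<exists>c\<in>A. (p, c) \<in> r \<and> (q, c) \<in> r"
      using A0 by (intro bexI[of _ "(max (fst p) (fst q), 0)"]) (auto simp: r_def)
  qed
  have "net_decreases_to_0 UNIV s ec_tail"
    unfolding net_decreases_to_0_def
  proof (intro conjI allI impI)
    show "directed_set UNIV s"
      unfolding directed_set_def preorder_on_def refl_on_def trans_def s_def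
      by (auto intro: max.cobounded1 max.cobounded2)
    show "\<forall>(g, h)\<in>s. ec_tail h \<le> ec_tail g" by (auto simp: s_def ec_tail_antimono)
    show "\<forall>g\<in>UNIV. 0 \<le> ec_tail g" by simp
    fix l assume l: "\<forall>g\<in>UNIV. l \<le> ec_tail g"
    have "ec_nth l n \<le> 0" for n
    proof -
      have "l \<le> ec_tail (Suc n)" using l by blast
      then have "ec_nth l n \<le> ec_nth (ec_tail (Suc n)) n"
        unfolding less_eq_ec_seq.rep_eq by blast
      then show ?thesis by simp
    qed
    then show "l \<le> 0" by (simp add: less_eq_ec_seq.rep_eq)
  qed
  moreover have "dominates_tails UNIV ec_tail A r snd 0"
    unfolding dominates_tails_def
  proof
    fix n :: nat
    show "\<exists>a0\<in>A. \<forall>a\<in>A. (a0, a) \<in> r \<longrightarrow> riesz_abs (snd a - 0) \<le> ec_tail n"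
      using A0 ec_tail_antimono
      by (intro bexI[of _ "(n, 0)"]) (fastforce simp: r_def A_def intro: order_trans)+
  qed
  ultimately have "order_converges A r snd 0" by (rule order_convergesI)
  from order_continuous_operatorsD[OF T dir this]
  obtain G s' b where b: "net_decreases_to_0 (G::'b set) s' b"
    and dom: "dominates_tails G b A r (\<lambda>a. T (snd a)) 0"
    unfolding order_converges_def by blast
  have mem: "b g \<in> tail_bounds T" if "g \<in> G" for g
  proof -
    from dom that obtain p where p: "p \<in> A"
      and le: "\<And>q. q \<in> A \<Longrightarrow> (p, q) \<in> r \<Longrightarrow> riesz_abs (T (snd q) - 0) \<le> b g"
      unfolding dominates_tails_def by blast
    have "riesz_abs (T x) \<le> b g" if "riesz_abs x \<le> ec_tail (fst p)" for x
      using le[of "(fst p, x)"] that p by (simp add: A_def r_def)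
    then show ?thesis unfolding tail_bounds_def by blast
  qed
  moreover have "G \<noteq> {}" using b by (auto simp: net_decreases_to_0_def directed_set_def)
  moreover have "l \<le> 0" if "\<forall>c\<in>tail_bounds T. l \<le> c" for l
    using b that mem unfolding net_decreases_to_0_def by blast
  ultimately show ?thesis
    unfolding has_inf_0_def using tail_bounds_nonneg by blast
qed

text \<open>A net that converges to \<open>0\<close> in order is eventually bounded by a constant \<open>K\<close> and converges to \<open>0\<close> in
  every coordinate. Beyond the first \<open>N\<close> coordinates a tail bound \<open>c\<close> gives the estimate \<open>K c\<close>; the
  first \<open>N\<close> coordinates contribute an arbitrarily small multiple of one fixed vector \<open>v\<close>, which the
  Archimedean property removes.\<close>

lemma order_continuous_if_tail_bounds_inf_0:
  fixes T :: "ec_seq \<Rightarrow> 'b::archimedean_riesz_space"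
  assumes T: "linear T" and B: "has_inf_0 (tail_bounds T)"
  shows "T \<in> order_continuous_operators"
  unfolding order_continuous_operators_def
proof (intro CollectI conjI allI impI T)
  fix A :: "(ec_seq \<times> ec_seq set) set" and r and x :: "ec_seq \<times> ec_seq set \<Rightarrow> ec_seq"
  assume dir: "directed_set A r" and "order_converges A r x 0"
  then obtain G s b where b: "net_decreases_to_0 (G::ec_seq set) s b"
    and dom: "dominates_tails G b A r x 0"
    unfolding order_converges_def by blast
  from b obtain g0 where g0: "g0 \<in> G" by (auto simp: net_decreases_to_0_def directed_set_def)
  obtain K where K: "0 < K" "\<And>n. \<bar>ec_nth (b g0) n\<bar> \<le> K" using ec_seq_bounded by blast
  have ev: "\<exists>a0\<in>A. \<forall>a\<in>A. (a0, a) \<in> r \<longrightarrow> (\<forall>n. \<bar>ec_nth (x a) n\<bar> \<le> ec_nth (b g) n)"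
    if "g \<in> G" for g
    using dom that by (simp add: dominates_tails_def less_eq_ec_seq.rep_eq)
  have bounded: "\<exists>a0\<in>A. \<forall>a\<in>A. (a0, a) \<in> r \<longrightarrow> (\<forall>n. \<bar>ec_nth (x a) n\<bar> \<le> K)"
    using ev[OF g0] K(2) by (meson abs_le_D1 order_trans)
  have small: "\<exists>a0\<in>A. \<forall>a\<in>A. (a0, a) \<in> r \<longrightarrow> \<bar>ec_nth (x a) n\<bar> \<le> \<epsilon>" if "0 < \<epsilon>" for n \<epsilon>
  proof -
    have "\<exists>g\<in>G. ec_nth (b g) n < \<epsilon>"
    proof (rule ccontr)
      assume "\<not> ?thesis"
      then have "\<forall>g\<in>G. \<epsilon> *\<^sub>R ec_unit n \<le> b g"
        using b by (auto simp: less_eq_ec_seq.rep_eq net_decreases_to_0_def not_less)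
      then have "\<epsilon> *\<^sub>R ec_unit n \<le> 0" using b by (auto simp: net_decreases_to_0_def)
      then have "ec_nth (\<epsilon> *\<^sub>R ec_unit n) n \<le> ec_nth 0 n"
        unfolding less_eq_ec_seq.rep_eq by blast
      with that show False by simp
    qed
    then obtain g where "g \<in> G" "ec_nth (b g) n < \<epsilon>" by blast
    with ev[of g] show ?thesis by (meson less_imp_le order_trans)
  qed
  let ?B = "{c. \<exists>a0\<in>A. \<forall>a\<in>A. (a0, a) \<in> r \<longrightarrow> riesz_abs (T (x a) - 0) \<le> c}"
  have bound: "\<exists>v. \<forall>\<epsilon>>0. K *\<^sub>R c + \<epsilon> *\<^sub>R v \<in> ?B" if c: "c \<in> tail_bounds T" for c
  proof -
    obtain N where N: "\<And>y. riesz_abs y \<le> ec_tail N \<Longrightarrow> riesz_abs (T y) \<le> c"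
      using c by (rule tail_boundsE) blast
    define v where "v = (\<Sum>n<N. riesz_abs (T (ec_unit n)))"
    have "K *\<^sub>R c + \<epsilon> *\<^sub>R v \<in> ?B" if \<epsilon>: "0 < \<epsilon>" for \<epsilon>
    proof -
      have est: "riesz_abs (T y) \<le> K *\<^sub>R c + \<epsilon> *\<^sub>R v"
        if y: "\<forall>n. \<bar>ec_nth y n\<bar> \<le> K" "\<forall>n<N. \<bar>ec_nth y n\<bar> \<le> \<epsilon>" for y
      proof -
        define h where "h = (\<Sum>n<N. ec_nth y n *\<^sub>R ec_unit n)"
        define z where "z = (1/K) *\<^sub>R (y - h)"
        have h_nth: "ec_nth h k = (if k < N then ec_nth y k else 0)" for k
          by (simp add: h_def if_distrib[of "\<lambda>u. _ * u"] cong: if_cong)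
        have "riesz_abs z \<le> ec_tail N"
          using y(1) K(1) by (auto simp: tail_bound_nth_le z_def h_nth abs_mult)
        then have "riesz_abs (T z) \<le> c" by (rule N)
        then have "K *\<^sub>R riesz_abs (T z) \<le> K *\<^sub>R c" using K(1) by (intro scaleR_left_mono) auto
        then have z: "riesz_abs (K *\<^sub>R T z) \<le> K *\<^sub>R c"
          using riesz_abs_scaleR[of K "T z"] K(1) by simp
        have "riesz_abs (T h) \<le> (\<Sum>n<N. riesz_abs (ec_nth y n *\<^sub>R T (ec_unit n)))"
          unfolding h_def by (simp add: linear_sum[OF T] linear_scale[OF T] riesz_abs_sum)
        also have "\<dots> \<le> (\<Sum>n<N. \<epsilon> *\<^sub>R riesz_abs (T (ec_unit n)))"
        proof (rule sum_mono)
          fix n assume "n \<in> {..<N}"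
          then have "\<bar>ec_nth y n\<bar> *\<^sub>R riesz_abs (T (ec_unit n)) \<le> \<epsilon> *\<^sub>R riesz_abs (T (ec_unit n))"
            using y(2) by (intro scaleR_right_mono riesz_abs_nonneg) auto
          then show "riesz_abs (ec_nth y n *\<^sub>R T (ec_unit n)) \<le> \<epsilon> *\<^sub>R riesz_abs (T (ec_unit n))"
            using riesz_abs_scaleR order_trans by blast
        qed
        finally have h: "riesz_abs (T h) \<le> \<epsilon> *\<^sub>R v" by (simp add: v_def scaleR_sum_right)
        have "y = K *\<^sub>R z + h" using K(1) by (simp add: z_def)
        then have "T y = K *\<^sub>R T z + T h" by (simp add: linear_add[OF T] linear_scale[OF T])
        then show ?thesis using riesz_abs_triangle[of "K *\<^sub>R T z" "T h"] add_mono[OF z h] by simp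
      qed
      have "\<exists>a0\<in>A. \<forall>a\<in>A. (a0, a) \<in> r \<longrightarrow>
          (\<forall>n. \<bar>ec_nth (x a) n\<bar> \<le> K) \<and> (\<forall>n<N. \<bar>ec_nth (x a) n\<bar> \<le> \<epsilon>)"
        by (intro directed_eventually_conj[OF dir bounded] directed_eventually_all_less[OF dir] small \<epsilon>)
      with est show ?thesis by (simp add: Bex_def) meson
    qed
    then show ?thesis by blast
  qed
  show "order_converges A r (\<lambda>a. T (x a)) 0"
  proof (rule order_converges_if_bounds_inf_0[OF dir])
    show "has_inf_0 ?B"
      unfolding has_inf_0_def
    proof (intro conjI ballI allI impI)
      obtain c where c: "c \<in> tail_bounds T" using B by (auto simp: has_inf_0_def)
      show "?B \<noteq> {}" using bound[OF c] by (metis empty_iff zero_less_one)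
      show "0 \<le> c" if "c \<in> ?B" for c
      proof -
        from that obtain a0 where "a0 \<in> A" "\<And>a. a \<in> A \<Longrightarrow> (a0, a) \<in> r \<Longrightarrow> riesz_abs (T (x a) - 0) \<le> c"
          by blast
        moreover from \<open>a0 \<in> A\<close> have "(a0, a0) \<in> r"
          using dir by (auto simp: directed_set_def preorder_on_def refl_on_def)
        ultimately show ?thesis using riesz_abs_nonneg order_trans by blast
      qed
      fix l assume l: "\<forall>c\<in>?B. l \<le> c"
      have "l \<le> K *\<^sub>R c" if c: "c \<in> tail_bounds T" for c
      proof -
        obtain v where v: "\<And>\<epsilon>. 0 < \<epsilon> \<Longrightarrow> K *\<^sub>R c + \<epsilon> *\<^sub>R v \<in> ?B" using bound[OF c] by blast
        have "real n *\<^sub>R (l - K *\<^sub>R c) \<le> v" if "0 < n" for n :: nat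
        proof -
          have "l \<le> K *\<^sub>R c + (1 / real n) *\<^sub>R v" using that l v[of "1 / real n"] by auto
          then have "l - K *\<^sub>R c \<le> (1 / real n) *\<^sub>R v" by (simp add: algebra_simps)
          from scaleR_left_mono[OF this, of "real n"] that show ?thesis by simp
        qed
        from archimedean[OF this] show ?thesis by simp
      qed
      with has_inf_0_scaleD[OF B K(1)] show "l \<le> 0" by blast
    qed
  qed
qed

lemma order_continuous_imp_linear: "T \<in> order_continuous_operators \<Longrightarrow> linear T"
  by (simp add: order_continuous_operators_def)

lemma order_continuous_iff:
  fixes T :: "ec_seq \<Rightarrow> 'b::archimedean_riesz_space"
  shows "T \<in> order_continuous_operators \<longleftrightarrow> linear T \<and> has_inf_0 (tail_bounds T)"
  by (intro iffI conjI order_continuous_imp_linear tail_bounds_inf_0_if_order_continuous)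
    (simp_all add: order_continuous_if_tail_bounds_inf_0)

lemma subspace_order_continuous_operators:
  "subspace (order_continuous_operators :: (ec_seq \<Rightarrow> 'b::archimedean_riesz_space) set)"
proof (rule subspaceI)
  have "0 \<in> tail_bounds (0 :: ec_seq \<Rightarrow> 'b)" by (simp add: tail_bounds_def)
  then have "has_inf_0 (tail_bounds (0 :: ec_seq \<Rightarrow> 'b))"
    using tail_bounds_nonneg by (auto simp: has_inf_0_def)
  then show "(0 :: ec_seq \<Rightarrow> 'b) \<in> order_continuous_operators"
    by (simp add: order_continuous_iff linear_zero zero_fun_def)
next
  fix S T :: "ec_seq \<Rightarrow> 'b"
  assume "S \<in> order_continuous_operators" "T \<in> order_continuous_operators"
  then have S: "linear S" "has_inf_0 (tail_bounds S)" and T: "linear T" "has_inf_0 (tail_bounds T)"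
    by (auto simp: order_continuous_iff)
  have add: "b + c \<in> tail_bounds (S + T)" if bc: "b \<in> tail_bounds S" "c \<in> tail_bounds T" for b c
  proof -
    obtain M where M: "\<And>x. riesz_abs x \<le> ec_tail M \<Longrightarrow> riesz_abs (S x) \<le> b"
      using bc(1) by (rule tail_boundsE) blast
    obtain N where N: "\<And>x. riesz_abs x \<le> ec_tail N \<Longrightarrow> riesz_abs (T x) \<le> c"
      using bc(2) by (rule tail_boundsE) blast
    have "riesz_abs ((S + T) x) \<le> b + c" if "riesz_abs x \<le> ec_tail (max M N)" for x
    proof -
      have "riesz_abs x \<le> ec_tail M" "riesz_abs x \<le> ec_tail N"
        using that ec_tail_antimono[of M "max M N"] ec_tail_antimono[of N "max M N"] by auto
      then have "riesz_abs (S x) + riesz_abs (T x) \<le> b + c" by (intro add_mono M N)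
      then show ?thesis using riesz_abs_triangle[of "S x" "T x"] by simp
    qed
    then show ?thesis unfolding tail_bounds_def by blast
  qed
  have "has_inf_0 (tail_bounds (S + T))"
    unfolding has_inf_0_def
  proof (intro conjI ballI allI impI tail_bounds_nonneg)
    show "tail_bounds (S + T) \<noteq> {}" using S(2) T(2) add unfolding has_inf_0_def by blast
    fix l assume l: "\<forall>b\<in>tail_bounds (S + T). l \<le> b"
    have "l - c \<le> b" if "b \<in> tail_bounds S" "c \<in> tail_bounds T" for b c
      using l add[OF that] by (auto simp: algebra_simps)
    then have "l - c \<le> 0" if "c \<in> tail_bounds T" for c
      using S(2) that unfolding has_inf_0_def by blast
    then have "\<forall>c\<in>tail_bounds T. l \<le> c" by simp
    then show "l \<le> 0" using T(2) unfolding has_inf_0_def by blast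
  qed
  then show "S + T \<in> order_continuous_operators"
    using S(1) T(1) by (simp add: order_continuous_iff plus_fun_def linear_compose_add)
next
  fix k :: real and T :: "ec_seq \<Rightarrow> 'b"
  assume "T \<in> order_continuous_operators"
  then have T: "linear T" "has_inf_0 (tail_bounds T)" by (auto simp: order_continuous_iff)
  \<comment> \<open>The factor \<open>\<bar>k\<bar> + 1\<close> in place of \<open>\<bar>k\<bar>\<close> avoids a separate case \<open>k = 0\<close>.\<close>
  have scale: "(\<bar>k\<bar> + 1) *\<^sub>R b \<in> tail_bounds (k *\<^sub>R T)" if b: "b \<in> tail_bounds T" for b
  proof -
    obtain N where N: "\<And>x. riesz_abs x \<le> ec_tail N \<Longrightarrow> riesz_abs (T x) \<le> b"
      using b by (rule tail_boundsE) blast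
    have "riesz_abs ((k *\<^sub>R T) x) \<le> (\<bar>k\<bar> + 1) *\<^sub>R b" if x: "riesz_abs x \<le> ec_tail N" for x
    proof -
      have "riesz_abs ((k *\<^sub>R T) x) \<le> \<bar>k\<bar> *\<^sub>R riesz_abs (T x)"
        unfolding scaleR_fun_def by (rule riesz_abs_scaleR)
      also have "\<dots> \<le> (\<bar>k\<bar> + 1) *\<^sub>R b"
        using N[OF x] tail_bounds_nonneg[OF b] by (intro scaleR_mono) (auto simp: riesz_abs_nonneg)
      finally show ?thesis .
    qed
    then show ?thesis unfolding tail_bounds_def by blast
  qed
  have "has_inf_0 (tail_bounds (k *\<^sub>R T))"
    unfolding has_inf_0_def
  proof (intro conjI ballI allI impI tail_bounds_nonneg)
    show "tail_bounds (k *\<^sub>R T) \<noteq> {}" using T(2) scale unfolding has_inf_0_def by blast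
    fix l assume "\<forall>b\<in>tail_bounds (k *\<^sub>R T). l \<le> b"
    then show "l \<le> 0" using scale by (intro has_inf_0_scaleD[OF T(2), of "\<bar>k\<bar> + 1"]) auto
  qed
  then show "k *\<^sub>R T \<in> order_continuous_operators"
    using T(1) by (simp add: order_continuous_iff scaleR_fun_def linear_compose_scale_right)
qed


section \<open>Order continuous operators are regular\<close>

text \<open>The sum of the \<open>\<bar>T e\<^sub>n\<bar>\<close> is the supremum of \<open>T\<close> over all choices of signs on \<open>J\<close>, and every such choice
  stays in the interval \<open>[-w\<^sub>N, w\<^sub>N]\<close>. The argument \<open>x\<close>, which vanishes on \<open>J\<close>, holds the signs that the
  induction has already chosen.\<close>

lemma sum_abs_units_le_tail_bound:
  fixes T :: "ec_seq \<Rightarrow> 'b::riesz_space"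
  assumes T: "linear T" and b: "\<And>x. riesz_abs x \<le> ec_tail N \<Longrightarrow> riesz_abs (T x) \<le> b"
    and "finite J" "J \<subseteq> {N..}" and "riesz_abs x \<le> ec_tail N" "\<forall>n\<in>J. ec_nth x n = 0"
  shows "T x + (\<Sum>n\<in>J. riesz_abs (T (ec_unit n))) \<le> b"
  using assms(3-)
proof (induction J arbitrary: x rule: finite_induct)
  case empty
  then show ?case using b[of x] by (simp add: riesz_abs_le_iff)
next
  case (insert m J)
  have add: "T (x + \<sigma> *\<^sub>R ec_unit m) + (\<Sum>n\<in>J. riesz_abs (T (ec_unit n))) \<le> b" if "\<bar>\<sigma>\<bar> = 1" for \<sigma>
  proof (rule insert.IH)
    show "J \<subseteq> {N..}" using insert.prems by simp
    have nth: "\<bar>ec_nth x n\<bar> \<le> (if N \<le> n then 1 else 0)" for n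
      using insert.prems(2) unfolding tail_bound_nth_le by blast
    have "\<bar>ec_nth x n\<bar> \<le> 1" "\<not> N \<le> n \<Longrightarrow> ec_nth x n = 0" for n
      using nth[of n] by (auto split: if_splits)
    then show "riesz_abs (x + \<sigma> *\<^sub>R ec_unit m) \<le> ec_tail N"
      using insert.prems(1,3) that by (simp add: tail_bound_nth_le)
    show "\<forall>n\<in>J. ec_nth (x + \<sigma> *\<^sub>R ec_unit m) n = 0"
      using insert.prems(3) insert.hyps by auto
  qed
  from add[of 1] add[of "-1"]
  have "riesz_abs (T (ec_unit m)) \<le> b - T x - (\<Sum>n\<in>J. riesz_abs (T (ec_unit n)))"
    unfolding riesz_abs_le_iff by (simp add: linear_add[OF T] linear_diff[OF T] algebra_simps)
  then show ?case using insert.hyps by (simp add: algebra_simps)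
qed

text \<open>The modulus of \<open>T\<close> need not be available, but a positive operator above \<open>T\<close> is enough. Take
  \<open>S e\<^sub>n = \<bar>T e\<^sub>n\<bar>\<close> and let \<open>S\<close> have at \<open>1\<close> a value that dominates all partial sums of the \<open>\<bar>T e\<^sub>n\<bar>\<close>; a tail bound
  provides such a value.\<close>

lemma order_continuous_imp_regular:
  fixes T :: "ec_seq \<Rightarrow> 'b::archimedean_riesz_space"
  assumes "T \<in> order_continuous_operators"
  shows "T \<in> regular_operators"
proof -
  have T: "linear T" "has_inf_0 (tail_bounds T)"
    using assms by (auto simp: order_continuous_iff)
  then obtain b where "b \<in> tail_bounds T" by (auto simp: has_inf_0_def)
  then obtain N where N: "\<And>x. riesz_abs x \<le> ec_tail N \<Longrightarrow> riesz_abs (T x) \<le> b"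
    by (rule tail_boundsE) blast
  define t where "t n = riesz_abs (T (ec_unit n))" for n
  obtain S where S: "linear S" "\<And>n. S (ec_unit n) = t n"
    "\<And>M. S (ec_tail M) = ((\<Sum>n<N. t n) + b) - (\<Sum>n<M. t n)"
    using operator_with_given_coordinates[of t "(\<Sum>n<N. t n) + b"] by blast
  have S_tail: "T x \<le> S (ec_tail M)" if "N \<le> M" "riesz_abs x \<le> ec_tail M" for M x
  proof -
    have "\<bar>ec_nth x n\<bar> \<le> (if M \<le> n then 1 else 0)" for n
      using that(2) unfolding tail_bound_nth_le by blast
    then have "ec_nth x n = 0" if "n < M" for n
      using that by (metis abs_le_zero_iff not_less)
    moreover have "riesz_abs x \<le> ec_tail N" using that ec_tail_antimono order_trans by blast
    ultimately have "T x + (\<Sum>n\<in>{N..<M}. t n) \<le> b"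
      unfolding t_def by (intro sum_abs_units_le_tail_bound[OF T(1) N]) auto
    moreover have "(\<Sum>n<M. t n) = (\<Sum>n<N. t n) + (\<Sum>n\<in>{N..<M}. t n)"
      using sum.atLeastLessThan_concat[of 0 N M t] that(1) by (simp add: lessThan_atLeast0)
    ultimately show ?thesis unfolding S(3) by (simp add: algebra_simps)
  qed
  have "positive_operator S"
    using S_tail[of _ 0] S(1,2)
    by (intro positive_operatorI_units_tails[where N = N])
      (auto simp: t_def riesz_abs_nonneg linear_0[OF T(1)])
  moreover have "positive_operator (S - T)"
  proof (rule positive_operatorI_units_tails[where N = N])
    show "linear (S - T)" using linear_compose_sub[OF S(1) T(1)] by (simp add: fun_diff_def)
    show "0 \<le> (S - T) (ec_unit n)" for n by (simp add: S(2) t_def riesz_abs_ge)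
    show "0 \<le> (S - T) (ec_tail n)" if "N \<le> n" for n
      using S_tail[OF that, of "ec_tail n"] by (simp add: tail_bound_nth_le)
  qed
  moreover have "T = S - (S - T)" by simp
  ultimately show ?thesis unfolding regular_operators_def by blast
qed


section \<open>Disjointness from the operators supported at infinity\<close>

text \<open>These operators vanish at all unit sequences, so they are supported at infinity.\<close>

definition lim_operator :: "'b::riesz_space \<Rightarrow> ec_seq \<Rightarrow> 'b" where
  "lim_operator r x = ec_lim x *\<^sub>R r"

lemma lim_operator_basis [simp]: "lim_operator r (ec_unit n) = 0" "lim_operator r (ec_tail n) = r"
  by (simp_all add: lim_operator_def)

lemma linear_lim_operator: "linear (lim_operator r)"
  by (rule linearI) (simp_all add: lim_operator_def scaleR_add_left)

lemma positive_lim_operator: "0 \<le> r \<Longrightarrow> positive_operator (lim_operator r)"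
  by (rule positive_operatorI_units_tails[where N = 0]) (simp_all add: linear_lim_operator)

lemma lim_operator_regular: "lim_operator r \<in> regular_operators"
proof -
  have "lim_operator r = lim_operator (riesz_abs r) - lim_operator (riesz_abs r - r)"
    by (simp add: fun_eq_iff lim_operator_def scaleR_diff_right)
  then show ?thesis
    unfolding regular_operators_def
    using positive_lim_operator riesz_abs_nonneg riesz_abs_ge(1)[of r] by fastforce
qed

lemma operator_le_iff_units_tails:
  assumes S: "linear S" and T: "linear T"
  shows "operator_le S T \<longleftrightarrow>
    (\<forall>n. S (ec_unit n) \<le> T (ec_unit n)) \<and> (\<forall>n. S (ec_tail n) \<le> T (ec_tail n))"
proof
  assume "(\<forall>n. S (ec_unit n) \<le> T (ec_unit n)) \<and> (\<forall>n. S (ec_tail n) \<le> T (ec_tail n))"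
  moreover have "linear (T - S)" using linear_compose_sub[OF T S] by (simp add: fun_diff_def)
  ultimately have "positive_operator (T - S)"
    by (intro positive_operatorI_units_tails[where N = 0]) simp_all
  then show "operator_le S T" by (auto simp: positive_operator_def operator_le_def)
qed (auto simp: operator_le_def)

text \<open>Domination of \<open>\<plusminus>(T + lim \<cdot> r)\<close> by \<open>V\<close> is equivalent to \<open>\<bar>T e\<^sub>n\<bar> \<le> V e\<^sub>n\<close> and
  \<open>\<bar>T w\<^sub>N\<bar> + \<bar>r\<bar> \<le> V w\<^sub>N\<close>, where \<open>r\<close> may be replaced by \<open>-r\<close>. For the second inequality split \<open>w\<^sub>N\<close> into a finite
  block, where \<open>V\<close> has to cover \<open>T\<close>, and a late tail, where \<open>T\<close> is small and \<open>V\<close> has to cover \<open>r\<close>.\<close>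

lemma dominates_order_continuous_plus_lim:
  fixes T V :: "ec_seq \<Rightarrow> 'b::archimedean_riesz_space"
  assumes T: "linear T" and B: "has_inf_0 (tail_bounds T)" and V: "linear V"
    and le: "operator_le (T + lim_operator r) V" "operator_le (- T - lim_operator r) V"
  shows "operator_le (T - lim_operator r) V \<and> operator_le (- T + lim_operator r) V"
proof -
  have unit: "riesz_abs (T (ec_unit n)) \<le> V (ec_unit n)" for n
  proof -
    have "(T + lim_operator r) (ec_unit n) \<le> V (ec_unit n)"
      "(- T - lim_operator r) (ec_unit n) \<le> V (ec_unit n)"
      using le ec_basis_nonneg(1)[of n] unfolding operator_le_def by blast+
    then show ?thesis by (simp add: riesz_abs_le_iff)
  qed
  have tail: "riesz_abs (T (ec_tail N)) + riesz_abs r \<le> V (ec_tail N)" for N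
  proof -
    have "riesz_abs (T (ec_tail N)) + riesz_abs r - V (ec_tail N) \<le> 2 *\<^sub>R b"
      if b: "b \<in> tail_bounds T" for b
    proof -
      obtain N0 where N0: "\<And>x. riesz_abs x \<le> ec_tail N0 \<Longrightarrow> riesz_abs (T x) \<le> b"
        using b by (rule tail_boundsE) blast
      define M where "M = max N N0"
      have "riesz_abs (ec_tail M) \<le> ec_tail N0"
        by (auto simp: tail_bound_nth_le M_def)
      then have Mb: "riesz_abs (T (ec_tail M)) \<le> b" by (rule N0)
      \<comment> \<open>The block between \<open>N\<close> and \<open>M\<close> does not see the limit, so there \<open>V\<close> dominates \<open>T\<close> alone.\<close>
      define d where "d = ec_tail N - ec_tail M"
      have d: "0 \<le> d" "ec_lim d = 0"
        using ec_tail_antimono[of N M] by (auto simp: d_def M_def)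
      have "(T + lim_operator r) d \<le> V d" "(- T - lim_operator r) d \<le> V d"
        using le d(1) unfolding operator_le_def by blast+
      then have 1: "riesz_abs (T d) \<le> V d" using d(2) by (simp add: riesz_abs_le_iff lim_operator_def)
      have "(T + lim_operator r) (ec_tail M) \<le> V (ec_tail M)"
        "(- T - lim_operator r) (ec_tail M) \<le> V (ec_tail M)"
        using le ec_basis_nonneg(2)[of M] unfolding operator_le_def by blast+
      then have 2: "riesz_abs (T (ec_tail M) + r) \<le> V (ec_tail M)" by (simp add: riesz_abs_le_iff)
      have "riesz_abs (T (ec_tail N)) \<le> riesz_abs (T d) + riesz_abs (T (ec_tail M))"
        using riesz_abs_triangle[of "T d" "T (ec_tail M)"] by (simp add: d_def linear_diff[OF T])
      also have "\<dots> \<le> V d + b" using 1 Mb by (rule add_mono)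
      finally have 3: "riesz_abs (T (ec_tail N)) \<le> V d + b" .
      have "riesz_abs r \<le> riesz_abs (T (ec_tail M) + r) + riesz_abs (T (ec_tail M))"
        using riesz_abs_triangle[of "T (ec_tail M) + r" "- T (ec_tail M)"] by simp
      also have "\<dots> \<le> V (ec_tail M) + b" using 2 Mb by (rule add_mono)
      finally have "riesz_abs (T (ec_tail N)) + riesz_abs r \<le> (V d + b) + (V (ec_tail M) + b)"
        using 3 by (intro add_mono)
      moreover have "V (ec_tail N) = V d + V (ec_tail M)" by (simp add: d_def linear_diff[OF V])
      ultimately show ?thesis by (simp add: scaleR_2 algebra_simps)
    qed
    then have "riesz_abs (T (ec_tail N)) + riesz_abs r - V (ec_tail N) \<le> 0"
      by (intro has_inf_0_scaleD[OF B, of 2]) auto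
    then show ?thesis by simp
  qed
  have lin: "linear (T - lim_operator r)" "linear (- T + lim_operator r)"
    using linear_compose_sub[OF T linear_lim_operator[of r]]
      linear_compose_add[OF linear_compose_neg[OF T] linear_lim_operator[of r]]
    by (simp_all add: fun_diff_def plus_fun_def fun_Compl_def)
  have "T (ec_tail N) - r \<le> V (ec_tail N)" "- T (ec_tail N) + r \<le> V (ec_tail N)" for N
    using order_trans[OF add_mono[OF riesz_abs_ge(1)[of "T (ec_tail N)"] riesz_abs_ge(2)[of r]] tail]
      order_trans[OF add_mono[OF riesz_abs_ge(2)[of "T (ec_tail N)"] riesz_abs_ge(1)[of r]] tail]
    by simp_all
  with unit show ?thesis
    unfolding operator_le_iff_units_tails[OF lin(1) V] operator_le_iff_units_tails[OF lin(2) V]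
    by (simp add: riesz_abs_le_iff)
qed

lemma pov_disjoint_sym: "pov_disjoint X le x y \<longleftrightarrow> pov_disjoint X le y x"
proof -
  have "- x - y = - y - x" "y - x = - x + y" "x - y = - y + x" by simp_all
  then show ?thesis by (simp only: pov_disjoint_def insert_commute add.commute)
qed

lemma order_continuous_disjoint_lim:
  fixes T :: "ec_seq \<Rightarrow> 'b::archimedean_riesz_space"
  assumes "T \<in> order_continuous_operators"
  shows "pov_disjoint regular_operators operator_le T (lim_operator r)"
proof -
  have T: "linear T" "has_inf_0 (tail_bounds T)"
    using assms by (auto simp: order_continuous_iff)
  have neg: "lim_operator (- r) = - lim_operator r" by (simp add: fun_eq_iff lim_operator_def)
  show ?thesis
    unfolding pov_disjoint_def upper_bounds_def
    using dominates_order_continuous_plus_lim[OF T regular_imp_linear, of _ r]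
      dominates_order_continuous_plus_lim[OF T regular_imp_linear, of _ "- r"]
    by (auto simp: neg)
qed

text \<open>The hypothesis says that whenever the shift of \<open>c\<close> by \<open>z\<close> is nonnegative, so is the shift by \<open>z - y\<close>.
  Iteration from \<open>z = 0\<close> gives \<open>k y \<le> c 0\<close> for all \<open>k\<close>.\<close>

lemma inf_of_shifts_le_0:
  fixes c :: "nat \<Rightarrow> 'b::archimedean_riesz_space"
  assumes c: "\<And>n. 0 \<le> c n"
    and y: "\<And>z N. (\<And>n. 0 \<le> z + c n) \<Longrightarrow> y \<le> z + c N"
  shows "y \<le> 0"
proof -
  have "0 \<le> - (real k *\<^sub>R y) + c n" for k n
  proof (induction k arbitrary: n)
    case 0
    then show ?case using c by simp
  next
    case (Suc k)
    from y[OF this, of n] show ?case by (simp add: algebra_simps)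
  qed
  from this[of _ 0] have "real k *\<^sub>R y \<le> c 0" for k by (simp add: algebra_simps)
  then show ?thesis by (rule archimedean)
qed

text \<open>Tail bounds of \<open>T\<close> come from the operators \<open>P + Q\<close>, where \<open>P\<close> and \<open>Q\<close> arise from the two parts of \<open>T\<close> by
  shifting the values at infinity. Disjointness is what allows to conclude from \<open>P + Q \<ge> \<plusminus>(P - Q)\<close> that
  \<open>P + Q\<close> dominates \<open>T\<close> itself, since \<open>P - Q\<close> differs from \<open>T\<close> by some \<open>lim \<cdot> r\<close>.\<close>

lemma disjoint_from_lim_imp_order_continuous:
  fixes T :: "ec_seq \<Rightarrow> 'b::archimedean_riesz_space"
  assumes "T \<in> regular_operators"
    and disj: "\<And>r. pov_disjoint regular_operators operator_le T (lim_operator r)"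
  shows "T \<in> order_continuous_operators"
proof -
  obtain T1 T2 where T12: "T = T1 - T2" and pos: "positive_operator T1" "positive_operator T2"
    using assms(1) by (auto simp: regular_operators_def)
  then have lin: "linear T1" "linear T2" by (auto simp: positive_operator_def)
  have T: "linear T" using assms(1) by (rule regular_imp_linear)
  define c where "c n = T1 (ec_tail n)" for n
  define d where "d n = T2 (ec_tail n)" for n
  have c0: "0 \<le> c n" and d0: "0 \<le> d n" for n
    using pos by (auto simp: c_def d_def positive_operator_def)
  have anti: "c n \<le> c m" "d n \<le> d m" if "m \<le> n" for m n
    using pos positive_operator_mono ec_tail_antimono[OF that] by (auto simp: c_def d_def)
  have mem: "(z + c N) + (w + d N) \<in> tail_bounds T"
    if z: "\<And>n. 0 \<le> z + c n" and w: "\<And>n. 0 \<le> w + d n" for z w N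
  proof -
    define P where "P = T1 + lim_operator z"
    define Q where "Q = T2 + lim_operator w"
    have P: "positive_operator P"
      using linear_compose_add[OF lin(1) linear_lim_operator[of z]] pos(1) z
      by (intro positive_operatorI_units_tails[where N = 0])
        (auto simp: P_def plus_fun_def c_def positive_operator_def add.commute)
    have Q: "positive_operator Q"
      using linear_compose_add[OF lin(2) linear_lim_operator[of w]] pos(2) w
      by (intro positive_operatorI_units_tails[where N = 0])
        (auto simp: Q_def plus_fun_def d_def positive_operator_def add.commute)
    have PQ: "positive_operator (P + Q)" by (rule positive_operator_add[OF P Q])
    define R where "R = lim_operator (z - w)"
    have TR: "T + R = P - Q"
      by (simp add: T12 R_def P_def Q_def fun_eq_iff lim_operator_def algebra_simps)
    have TR': "- T - R = Q - P" using arg_cong[OF TR, of uminus] by simp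
    have ineq: "x - y \<le> x + y" if "0 \<le> y" for x y :: 'b
    proof -
      have "- y \<le> y" using that by (intro order_trans[of "- y" 0 y]) auto
      from add_left_mono[OF this, of x] show ?thesis by simp
    qed
    have plus: "operator_le (T + R) (P + Q)" "operator_le (- T - R) (P + Q)"
      unfolding TR TR' operator_le_def
      using P Q ineq by (auto simp: positive_operator_def add.commute)
    then have minus: "operator_le (T - R) (P + Q)" "operator_le (- T + R) (P + Q)"
      using disj[of "z - w"] positive_imp_regular[OF PQ]
      unfolding pov_disjoint_def upper_bounds_def R_def by blast+
    have V: "linear (P + Q)" using PQ by (simp add: positive_operator_def)
    have le: "T x \<le> (P + Q) x" "- T x \<le> (P + Q) x" if "0 \<le> x" for x
    proof -
      have *: "u \<le> v" if "u + f \<le> v" "u - f \<le> v" for u v f :: 'b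
      proof -
        have "(u + f) + (u - f) \<le> v + v" using that by (intro add_mono)
        then have "u + u \<le> v + v" by simp
        then show ?thesis by (rule add_self_le_imp_le)
      qed
      show "T x \<le> (P + Q) x"
        by (rule *[of "T x" "R x"]) (use plus(1) minus(1) that in \<open>auto simp: operator_le_def\<close>)
      show "- T x \<le> (P + Q) x"
        by (rule *[of "- T x" "R x"]) (use plus(2) minus(2) that in \<open>auto simp: operator_le_def\<close>)
    qed
    have "riesz_abs (T x) \<le> (z + c N) + (w + d N)" if "riesz_abs x \<le> ec_tail N" for x
    proof -
      have "riesz_abs (T x) \<le> (P + Q) (riesz_abs x)"
        by (rule operator_dominated_abs_le[OF T V le])
      also have "\<dots> \<le> (P + Q) (ec_tail N)" by (rule positive_operator_mono[OF PQ that])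
      finally show ?thesis by (simp add: P_def Q_def c_def d_def add_ac)
    qed
    then show ?thesis unfolding tail_bounds_def by blast
  qed
  have "has_inf_0 (tail_bounds T)"
    unfolding has_inf_0_def
  proof (intro conjI ballI allI impI tail_bounds_nonneg)
    show "tail_bounds T \<noteq> {}" using mem[of 0 0 0] c0 d0 by auto
    fix l assume l: "\<forall>b\<in>tail_bounds T. l \<le> b"
    \<comment> \<open>Both tails decrease, so the two indices may be separated and the infima taken one after the other.\<close>
    have le: "l \<le> (z + c N) + (w + d M)"
      if z: "\<And>n. 0 \<le> z + c n" and w: "\<And>n. 0 \<le> w + d n" for z w N M
    proof -
      have "l \<le> (z + c (max N M)) + (w + d (max N M))" using l mem[OF z w] by blast
      also have "\<dots> \<le> (z + c N) + (w + d M)" by (intro add_mono anti order_refl) auto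
      finally show ?thesis .
    qed
    show "l \<le> 0"
    proof (rule inf_of_shifts_le_0[of d, OF d0])
      fix w M assume w: "\<And>n. 0 \<le> w + d n"
      have "l - (w + d M) \<le> 0"
      proof (rule inf_of_shifts_le_0[of c, OF c0])
        fix z N assume "\<And>n. 0 \<le> z + c n"
        from le[OF this w] show "l - (w + d M) \<le> z + c N" by (simp add: algebra_simps)
      qed
      then show "l \<le> w + d M" by simp
    qed
  qed
  with T show ?thesis by (simp add: order_continuous_iff)
qed


section \<open>The band property\<close>

theorem theorem4p3:
  shows "is_band regular_operators operator_le
    (order_continuous_operators :: (ec_seq \<Rightarrow> 'f::archimedean_riesz_space) set)"
proof -
  let ?X = "regular_operators :: (ec_seq \<Rightarrow> 'f) set"
  let ?Y = "order_continuous_operators :: (ec_seq \<Rightarrow> 'f) set"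
  let ?c = "disjoint_complement ?X operator_le"
  have sub: "?Y \<subseteq> ?X" using order_continuous_imp_regular by blast
  have lim: "lim_operator r \<in> ?c ?Y" for r
    unfolding disjoint_complement_def
    using lim_operator_regular order_continuous_disjoint_lim pov_disjoint_sym by blast
  have "?c (?c ?Y) = ?Y"
  proof
    show "?Y \<subseteq> ?c (?c ?Y)"
      using sub pov_disjoint_sym unfolding disjoint_complement_def by blast
    show "?c (?c ?Y) \<subseteq> ?Y"
    proof
      fix T assume T: "T \<in> ?c (?c ?Y)"
      show "T \<in> ?Y"
      proof (rule disjoint_from_lim_imp_order_continuous)
        show "T \<in> ?X" using T by (simp add: disjoint_complement_def)
        show "pov_disjoint ?X operator_le T (lim_operator r)" for r
          using T lim[of r] unfolding disjoint_complement_def by blast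
      qed
    qed
  qed
  with sub show ?thesis
    by (simp add: is_band_def subspace_order_continuous_operators)
qed

end
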